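(* Let $(K,\leq)$ be a finite abstract simplicial complex with vertex set $V=\{1,2,\ldots,n\}=K_{(0)}$, let $R$ be a commutative ring with identity, and let $w:K\rightarrow R$ be a weight function with values in $R$, i.e. a function such that $w(\sigma)\mid w(\tau)$ in $R$ whenever $\sigma\leq\tau$. Let $\mathcal{F}:(K,\leq)^{\mathrm{op}}\rightarrow\mathsf{Mod}_R$ be the cellular sheaf with $\mathcal{F}_\sigma=R$ for every $\sigma\in K$ and with $\mathcal{F}_{\tau,\sigma}:R\rightarrow R$ the $R$-module homomorphism $r\mapsto (w(\tau)/w(\sigma))\cdot r$ for every pair $\sigma\leq\tau$ in $K$. Then $$H_q(K;w)=H^q(K;\mathcal{F})$$ for every $q\in\mathbb{Z}_{\geq 0}$, where $H_q(K;w)=\ker(\partial_q^w)/\operatorname{im}(\partial_{q+1}^w)$ is the $q$-th weighted homology and $H^q(K;\mathcal{F})$ is the $q$-th sheaf cohomology of $\mathcal{F}$.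
   Context: A simplicial complex $K$ on $V=\{1,\dots,n\}$ is a collection of non-empty subsets of $V$ (simplices), containing every singleton, such that every non-empty subset of a member of $K$ is in $K$; $\sigma\leq\tau$ means $\sigma\subseteq\tau$. $K_{(q)}$ is the set of $q$-simplices (simplices with $q+1$ elements), each written uniquely as $[i_0,\ldots,i_q]$ with $i_0<\cdots<i_q$. For $\tau=[i_0,\ldots,i_q]$ write $d_k(\tau)=[i_0,\ldots,\widehat{i_k},\ldots,i_q]$ for its $k$-th face. The incidence sign is $[\sigma:\tau]=(-1)^k$ if $\sigma=d_k(\tau)$, and $[\sigma:\tau]=0$ if $\sigma$ is not of this form. $\mathsf{Mod}_R$ is the category of $R$-modules. For $\sigma\leq\tau$, $w(\tau)/w(\sigma)$ denotes the quotient in $R$ of $w(\tau)$ by its divisor $w(\sigma)$, i.e. an element $a\in R$ with $w(\tau)=a\,w(\sigma)$; the same quotients are used in the definitions of $\partial_q^w$ and of $\mathcal{F}$, and they are taken to satisfy $w(\rho)/w(\sigma)=(w(\tau)/w(\sigma))\cdot(w(\rho)/w(\tau))$ for $\sigma\leq\tau\leq\rho$, which is what makes $\mathcal{F}$ a functor. Weighted homology: $C_q(K;R)=\bigoplus_{\sigma\in K_{(q)}}R\sigma$ is the free $R$-module on the $q$-simplices. The weighted boundary map $\partial_q^w:C_q(K;R)\to C_{q-1}(K;R)$, $q\geq1$, is the $R$-linear map with $$\partial_q^w(\sigma)=\sum_{k=0}^q(-1)^k\,\frac{w(\sigma)}{w(d_k(\sigma))}\,d_k(\sigma)\qquad(\sigma\in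 K_{(q)}),$$ and $\partial_0^w=0$. One has $\partial_{q}^w\circ\partial_{q+1}^w=0$ for all $q\geq 0$. A functor $\mathcal{F}:(K,\leq)^{\mathrm{op}}\to\mathsf{Mod}_R$ (called here a cellular sheaf on the opposite poset; elsewhere often a cellular cosheaf) assigns to each $\sigma\in K$ an $R$-module $\mathcal{F}_\sigma$ and to each pair $\sigma\leq\tau$ an $R$-linear map $\mathcal{F}_{\tau,\sigma}:\mathcal{F}_\tau\to\mathcal{F}_\sigma$, functorially. Its cochain modules are $C^q(K;\mathcal{F})=\prod_{\sigma\in K_{(q)}}\mathcal{F}_\sigma$; for the $\mathcal{F}$ of the claim this is identified with $C_q(K;R)$, the factor $\mathcal{F}_\sigma=R$ corresponding to $R\sigma$. Because $\mathcal{F}$ is defined on the opposite poset, the coboundary maps lower the degree: $\delta^q:C^q(K;\mathcal{F})\to C^{q-1}(K;\mathcal{F})$ is given on the summand $\mathcal{F}_\tau$, $\tau\in K_{(q)}$, by $$\delta^q|_{\mathcal{F}_\tau}=\sum_{\sigma\in K_{(q-1)}}[\sigma:\tau]\cdot\mathcal{F}_{\tau,\sigma}$$ (terms with $\sigma\not\leq\tau$ being zero), with $\delta^0=0$. The sheaf cohomology is $H^q(K;\mathcal{F})=\ker(\delta^q)/\operatorname{im}(\delta^{q+1})$. *)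

theory Defs
  imports "HOL-Algebra.Module" "HOL-Algebra.AbelCoset" "HOL-Algebra.Divisibility"
begin

section \<open>Modules\<close>

text \<open>
  The library represents a module by an extension of a ring record. The ring multiplication and
  unit play no role for modules (the locale \<^locale>\<open>module\<close> does not mention them), so these two
  fields are filled by \<^const>\<open>undefined\<close> where there is no natural candidate.
\<close>

definition self_module :: "('a, 'r) ring_scheme \<Rightarrow> ('a, 'a) module" where
  "self_module R =
     \<lparr>carrier = carrier R, monoid.mult = monoid.mult R, one = one R, zero = zero R, add = add R,
      smult = monoid.mult R\<rparr>"

definition linear_maps ::
    "('a, 'r) ring_scheme \<Rightarrow> ('a, 'b, 'm) module_scheme \<Rightarrow> ('a, 'c, 'n) module_scheme \<Rightarrow> ('b \<Rightarrow> 'c) set"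
where
  "linear_maps R M N =
     {f \<in> hom (add_monoid M) (add_monoid N).
        \<forall>a\<in>carrier R. \<forall>x\<in>carrier M. f (a \<odot>\<^bsub>M\<^esub> x) = a \<odot>\<^bsub>N\<^esub> f x}"

definition product_module ::
    "'i set \<Rightarrow> ('i \<Rightarrow> ('a, 'b, 'm) module_scheme) \<Rightarrow> ('a, 'i \<Rightarrow> 'b) module"
where
  "product_module I M =
     \<lparr>carrier = (\<Pi>\<^sub>E i\<in>I. carrier (M i)),
      monoid.mult = undefined, one = undefined,
      zero = (\<lambda>i\<in>I. \<zero>\<^bsub>M i\<^esub>),
      add = (\<lambda>x y. \<lambda>i\<in>I. x i \<oplus>\<^bsub>M i\<^esub> y i),
      smult = (\<lambda>a x. \<lambda>i\<in>I. a \<odot>\<^bsub>M i\<^esub> x i)\<rparr>"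

definition direct_sum_module ::
    "'i set \<Rightarrow> ('i \<Rightarrow> ('a, 'b, 'm) module_scheme) \<Rightarrow> ('a, 'i \<Rightarrow> 'b) module"
where
  "direct_sum_module I M =
     (product_module I M)
       \<lparr>carrier := {x \<in> carrier (product_module I M). finite {i \<in> I. x i \<noteq> \<zero>\<^bsub>M i\<^esub>}}\<rparr>"

text \<open>
  The quotient \<open>M / N\<close> by a submodule \<open>N\<close>; its elements are the cosets of \<open>N\<close>. The scalar
  multiplication follows the pattern of \<open>rcoset_mult\<close> for quotient rings: it sends
  \<open>N +> x\<close> to \<open>N +> (a \<odot> x)\<close>.
\<close>

definition quotient_module :: "('a, 'b, 'm) module_scheme \<Rightarrow> 'b set \<Rightarrow> ('a, 'b set) module" where
  "quotient_module M N =
     \<lparr>carrier = a_rcosets\<^bsub>M\<^esub> N,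
      monoid.mult = undefined, one = undefined,
      zero = N,
      add = (\<lambda>X Y. X <+>\<^bsub>M\<^esub> Y),
      smult = (\<lambda>a X. \<Union>x\<in>X. N +>\<^bsub>M\<^esub> (a \<odot>\<^bsub>M\<^esub> x))\<rparr>"

text \<open>The module \<open>ker d / im e\<close> for maps \<open>e : L \<rightarrow> M\<close> and \<open>d : M \<rightarrow> N\<close>.\<close>

definition homology_module ::
    "('a, 'l, 'p) module_scheme \<Rightarrow> ('l \<Rightarrow> 'b) \<Rightarrow> ('a, 'b) module
      \<Rightarrow> ('b \<Rightarrow> 'c) \<Rightarrow> ('a, 'c, 'o) module_scheme \<Rightarrow> ('a, 'b set) module"
where
  "homology_module L e M d N = quotient_module (M\<lparr>carrier := a_kernel M N d\<rparr>) (e ` carrier L)"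


section \<open>Simplicial complexes\<close>

definition simplicial_complex :: "nat \<Rightarrow> nat set set \<Rightarrow> bool" where
  "simplicial_complex n K \<longleftrightarrow>
     (\<forall>\<sigma>\<in>K. \<sigma> \<noteq> {} \<and> \<sigma> \<subseteq> {1..n}) \<and>
     (\<forall>v\<in>{1..n}. {v} \<in> K) \<and>
     (\<forall>\<tau>\<in>K. \<forall>\<sigma>. \<sigma> \<noteq> {} \<and> \<sigma> \<subseteq> \<tau> \<longrightarrow> \<sigma> \<in> K)"

text \<open>
  Degrees are integers, so that degree \<open>-1\<close> is available as the target of the maps in degree \<open>0\<close>.
  There are no simplices of negative dimension, since simplices are non-empty; the (co)chain
  modules of negative degree are therefore zero.
\<close>

definition simplices :: "nat set set \<Rightarrow> int \<Rightarrow> nat set set" where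
  "simplices K q = {\<sigma> \<in> K. int (card \<sigma>) = q + 1}"

definition face :: "nat \<Rightarrow> nat set \<Rightarrow> nat set" where
  "face k \<tau> = \<tau> - {sorted_list_of_set \<tau> ! k}"

definition incidence :: "nat set \<Rightarrow> nat set \<Rightarrow> int" where
  "incidence \<sigma> \<tau> =
     (if \<exists>k<card \<tau>. \<sigma> = face k \<tau> then (-1) ^ (THE k. k < card \<tau> \<and> \<sigma> = face k \<tau>) else 0)"


section \<open>Weights and weighted homology\<close>

definition weight_function :: "('a, 'r) ring_scheme \<Rightarrow> nat set set \<Rightarrow> (nat set \<Rightarrow> 'a) \<Rightarrow> bool" where
  "weight_function R K w \<longleftrightarrow>
     w \<in> K \<rightarrow> carrier R \<and> (\<forall>\<sigma>\<in>K. \<forall>\<tau>\<in>K. \<sigma> \<subseteq> \<tau> \<longrightarrow> w \<sigma> divides\<^bsub>R\<^esub> w \<tau>)"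

text \<open>
  If \<open>R\<close> has zero divisors, \<open>w \<tau> / w \<sigma>\<close> need not be determined by \<open>w\<close>. A choice of quotients is
  therefore a separate piece of data: \<open>quo \<tau> \<sigma>\<close> stands for \<open>w \<tau> / w \<sigma>\<close>.
  The normalisation \<open>quo \<sigma> \<sigma> = \<one>\<close> is not part of the definition; it is forced when multiplication
  by the quotients is required to be a functor.
\<close>

definition weight_quotients ::
    "('a, 'r) ring_scheme \<Rightarrow> nat set set \<Rightarrow> (nat set \<Rightarrow> 'a) \<Rightarrow> (nat set \<Rightarrow> nat set \<Rightarrow> 'a) \<Rightarrow> bool"
where
  "weight_quotients R K w quo \<longleftrightarrow>
     (\<forall>\<sigma>\<in>K. \<forall>\<tau>\<in>K. \<sigma> \<subseteq> \<tau> \<longrightarrow> quo \<tau> \<sigma> \<in> carrier R \<and> w \<tau> = quo \<tau> \<sigma> \<otimes>\<^bsub>R\<^esub> w \<sigma>) \<and>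
     (\<forall>\<sigma>\<in>K. \<forall>\<tau>\<in>K. \<forall>\<rho>\<in>K. \<sigma> \<subseteq> \<tau> \<and> \<tau> \<subseteq> \<rho> \<longrightarrow> quo \<rho> \<sigma> = quo \<tau> \<sigma> \<otimes>\<^bsub>R\<^esub> quo \<rho> \<tau>)"

text \<open>
  A chain is the family of its coefficients: the formal sum of the \<open>c \<sigma>\<close> times \<open>\<sigma>\<close> is the
  function \<open>c\<close>, and the basis element \<open>\<sigma>\<close> is \<open>basis_chain R K q \<sigma>\<close>.
\<close>

definition chains :: "('a, 'r) ring_scheme \<Rightarrow> nat set set \<Rightarrow> int \<Rightarrow> ('a, nat set \<Rightarrow> 'a) module" where
  "chains R K q = direct_sum_module (simplices K q) (\<lambda>_. self_module R)"

definition basis_chain ::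
    "('a, 'r) ring_scheme \<Rightarrow> nat set set \<Rightarrow> int \<Rightarrow> nat set \<Rightarrow> nat set \<Rightarrow> 'a"
where
  "basis_chain R K q \<sigma> = (\<lambda>\<tau>\<in>simplices K q. if \<tau> = \<sigma> then \<one>\<^bsub>R\<^esub> else \<zero>\<^bsub>R\<^esub>)"

text \<open>The value of the weighted boundary map on a simplex \<open>\<sigma>\<close> of dimension \<open>q \<ge> 1\<close>.\<close>

definition weighted_boundary_simplex ::
    "('a, 'r) ring_scheme \<Rightarrow> nat set set \<Rightarrow> (nat set \<Rightarrow> nat set \<Rightarrow> 'a) \<Rightarrow> int
      \<Rightarrow> nat set \<Rightarrow> nat set \<Rightarrow> 'a"
where
  "weighted_boundary_simplex R K quo q \<sigma> =
     (\<Oplus>\<^bsub>chains R K (q - 1)\<^esub> k \<in> {0..nat q}.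
        ([((-1) ^ k :: int)] \<cdot>\<^bsub>R\<^esub> quo \<sigma> (face k \<sigma>))
          \<odot>\<^bsub>chains R K (q - 1)\<^esub> basis_chain R K (q - 1) (face k \<sigma>))"

definition weighted_boundary ::
    "('a, 'r) ring_scheme \<Rightarrow> nat set set \<Rightarrow> (nat set \<Rightarrow> nat set \<Rightarrow> 'a) \<Rightarrow> int
      \<Rightarrow> (nat set \<Rightarrow> 'a) \<Rightarrow> nat set \<Rightarrow> 'a"
where
  "weighted_boundary R K quo q c =
     (if q \<le> 0 then \<zero>\<^bsub>chains R K (q - 1)\<^esub>
      else \<Oplus>\<^bsub>chains R K (q - 1)\<^esub> \<sigma> \<in> simplices K q.
             c \<sigma> \<odot>\<^bsub>chains R K (q - 1)\<^esub> weighted_boundary_simplex R K quo q \<sigma>)"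

definition weighted_homology ::
    "('a, 'r) ring_scheme \<Rightarrow> nat set set \<Rightarrow> (nat set \<Rightarrow> nat set \<Rightarrow> 'a) \<Rightarrow> int
      \<Rightarrow> ('a, (nat set \<Rightarrow> 'a) set) module"
where
  "weighted_homology R K quo q =
     homology_module
       (chains R K (q + 1)) (weighted_boundary R K quo (q + 1))
       (chains R K q) (weighted_boundary R K quo q) (chains R K (q - 1))"


section \<open>Cellular sheaves on the opposite face poset\<close>

text \<open>
  A functor from the opposite of \<open>(K, \<subseteq>)\<close> to modules: \<open>F \<sigma>\<close> is the value at \<open>\<sigma>\<close>, and for
  \<open>\<sigma> \<subseteq> \<tau>\<close> the structure map goes \<open>res \<tau> \<sigma> : F \<tau> \<rightarrow> F \<sigma>\<close>. All values share one type of elements,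
  but may have different carriers.
\<close>

locale cellular_sheaf_op =
  fixes R :: "('a, 'r) ring_scheme" and K :: "nat set set"
    and F :: "nat set \<Rightarrow> ('a, 'b) module"
    and res :: "nat set \<Rightarrow> nat set \<Rightarrow> 'b \<Rightarrow> 'b"
  assumes module_value: "\<sigma> \<in> K \<Longrightarrow> module R (F \<sigma>)"
    and res_linear: "\<lbrakk>\<sigma> \<in> K; \<tau> \<in> K; \<sigma> \<subseteq> \<tau>\<rbrakk> \<Longrightarrow> res \<tau> \<sigma> \<in> linear_maps R (F \<tau>) (F \<sigma>)"
    and res_id: "\<lbrakk>\<sigma> \<in> K; x \<in> carrier (F \<sigma>)\<rbrakk> \<Longrightarrow> res \<sigma> \<sigma> x = x"
    and res_comp: "\<lbrakk>\<sigma> \<in> K; \<tau> \<in> K; \<rho> \<in> K; \<sigma> \<subseteq> \<tau>; \<tau> \<subseteq> \<rho>; x \<in> carrier (F \<rho>)\<rbrakk>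
      \<Longrightarrow> res \<rho> \<sigma> x = res \<tau> \<sigma> (res \<rho> \<tau> x)"

text \<open>
  Cochains are families indexed by the simplices of dimension \<open>q\<close>. If every value \<open>F \<sigma>\<close> is
  \<open>self_module R\<close> and \<open>K\<close> is finite, this is the same set of functions as for \<^const>\<open>chains\<close>: the
  identification of the factor \<open>F \<sigma>\<close> with the multiples of the basis element \<open>\<sigma>\<close> is the
  identity, and the homology of the two complexes can be compared by equality.
\<close>

definition cochains ::
    "nat set set \<Rightarrow> (nat set \<Rightarrow> ('a, 'b) module) \<Rightarrow> int \<Rightarrow> ('a, nat set \<Rightarrow> 'b) module"
where
  "cochains K F q = product_module (simplices K q) F"

text \<open>
  The restriction of the coboundary to the summand \<open>F \<tau>\<close>, where \<open>\<tau>\<close> has dimension \<open>q\<close>; the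
  component of its value at \<open>\<sigma>\<close> is the incidence sign times \<open>res \<tau> \<sigma> v\<close>.
\<close>

definition coboundary_summand ::
    "nat set set \<Rightarrow> (nat set \<Rightarrow> ('a, 'b) module) \<Rightarrow> (nat set \<Rightarrow> nat set \<Rightarrow> 'b \<Rightarrow> 'b) \<Rightarrow> int
      \<Rightarrow> nat set \<Rightarrow> 'b \<Rightarrow> nat set \<Rightarrow> 'b"
where
  "coboundary_summand K F res q \<tau> v =
     (\<lambda>\<sigma>\<in>simplices K (q - 1).
        if \<sigma> \<subseteq> \<tau> then [incidence \<sigma> \<tau>] \<cdot>\<^bsub>F \<sigma>\<^esub> res \<tau> \<sigma> v else \<zero>\<^bsub>F \<sigma>\<^esub>)"

definition coboundary ::
    "nat set set \<Rightarrow> (nat set \<Rightarrow> ('a, 'b) module) \<Rightarrow> (nat set \<Rightarrow> nat set \<Rightarrow> 'b \<Rightarrow> 'b) \<Rightarrow> int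
      \<Rightarrow> (nat set \<Rightarrow> 'b) \<Rightarrow> nat set \<Rightarrow> 'b"
where
  "coboundary K F res q x =
     (if q \<le> 0 then \<zero>\<^bsub>cochains K F (q - 1)\<^esub>
      else \<Oplus>\<^bsub>cochains K F (q - 1)\<^esub> \<tau> \<in> simplices K q. coboundary_summand K F res q \<tau> (x \<tau>))"

definition sheaf_cohomology ::
    "nat set set \<Rightarrow> (nat set \<Rightarrow> ('a, 'b) module) \<Rightarrow> (nat set \<Rightarrow> nat set \<Rightarrow> 'b \<Rightarrow> 'b) \<Rightarrow> int
      \<Rightarrow> ('a, (nat set \<Rightarrow> 'b) set) module"
where
  "sheaf_cohomology K F res q =
     homology_module
       (cochains K F (q + 1)) (coboundary K F res (q + 1))
       (cochains K F q) (coboundary K F res q) (cochains K F (q - 1))"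

end

theory Submission
  imports Defs
begin

text \<open>
  The chain and cochain modules are the same records, so it suffices that the two boundary maps
  agree on the carriers. At a simplex \<open>\<rho>\<close> of codimension one, the boundary of \<open>\<tau>\<close> has at most one
  nonzero summand, since distinct \<open>k\<close> give distinct faces \<open>face k \<tau>\<close>, and the sign of this
  summand is the incidence sign.
\<close>

section \<open>Product modules and finite sums in them\<close>

lemma self_module_simps [simp]:
  "carrier (self_module R) = carrier R"
  "zero (self_module R) = zero R"
  "add (self_module R) = add R"
  "smult (self_module R) = monoid.mult R"
  by (simp_all add: self_module_def)

text \<open>Finite sums read only carrier, zero and addition, which \<open>self_module R\<close>
  shares with \<open>R\<close>. Componentwise sums arise in \<open>self_module R\<close>, while the
  ring lemmas speak of \<open>R\<close>.\<close>

lemma finsum_self_module: "finsum (self_module R) = finsum R"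
  by (intro ext) (simp add: finsum_def finprod_def)

lemma add_pow_self_module: "[(k::int)] \<cdot>\<^bsub>self_module R\<^esub> x = [k] \<cdot>\<^bsub>R\<^esub> x"
  by (simp add: add_pow_def int_pow_def nat_pow_def m_inv_def Let_def)

text \<open>Every field restricts its families to \<open>I\<close>, so values of \<open>M\<close>
  elsewhere leave no trace. This matters because the sheaf is prescribed on \<open>K\<close>
  only.\<close>

lemma product_module_cong:
  assumes "\<And>i. i \<in> I \<Longrightarrow> M i = N i"
  shows "product_module I M = product_module I N"
  using assms by (auto simp: product_module_def fun_eq_iff restrict_def intro!: PiE_cong)

lemma direct_sum_module_finite:
  assumes "finite I"
  shows "direct_sum_module I M = product_module I M"
  using assms by (simp add: direct_sum_module_def product_module_def)

lemma abelian_monoid_product_module: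
  assumes "\<And>i. i \<in> I \<Longrightarrow> abelian_monoid (M i)"
  shows "abelian_monoid (product_module I M)"
proof (rule abelian_monoidI)
  show "x \<oplus>\<^bsub>product_module I M\<^esub> y \<in> carrier (product_module I M)"
    if "x \<in> carrier (product_module I M)" "y \<in> carrier (product_module I M)" for x y
    using that assms
    by (auto simp: product_module_def PiE_iff intro!: abelian_monoid.a_closed)
  show "\<zero>\<^bsub>product_module I M\<^esub> \<in> carrier (product_module I M)"
    using assms by (auto simp: product_module_def intro: abelian_monoid.zero_closed)
  show "x \<oplus>\<^bsub>product_module I M\<^esub> y \<oplus>\<^bsub>product_module I M\<^esub> z
      = x \<oplus>\<^bsub>product_module I M\<^esub> (y \<oplus>\<^bsub>product_module I M\<^esub> z)"
    if "x \<in> carrier (product_module I M)" "y \<in> carrier (product_module I M)"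
      "z \<in> carrier (product_module I M)" for x y z
    using that assms
    by (auto simp: product_module_def PiE_iff intro!: restrict_ext abelian_monoid.a_assoc)
  show "\<zero>\<^bsub>product_module I M\<^esub> \<oplus>\<^bsub>product_module I M\<^esub> x = x"
    if "x \<in> carrier (product_module I M)" for x
    using that assms
    \<comment> \<open>Outside \<open>I\<close> both sides are \<open>undefined\<close>: the sum by
      restriction, \<open>x\<close> by extensionality.\<close>
    by (intro ext) (auto simp: product_module_def PiE_iff extensional_def abelian_monoid.l_zero)
  show "x \<oplus>\<^bsub>product_module I M\<^esub> y = y \<oplus>\<^bsub>product_module I M\<^esub> x"
    if "x \<in> carrier (product_module I M)" "y \<in> carrier (product_module I M)" for x y
    using that assms
    by (auto simp: product_module_def PiE_iff intro!: restrict_ext abelian_monoid.a_comm)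
qed

text \<open>Evaluation at \<open>i\<close> is additive and preserves zero, so it passes through the
  sum by induction on the index set.\<close>

lemma finsum_product_module_apply:
  assumes M: "\<And>i. i \<in> I \<Longrightarrow> abelian_monoid (M i)"
    and f: "f \<in> A \<rightarrow> carrier (product_module I M)"
    and i: "i \<in> I"
  shows "finsum (product_module I M) f A i = (\<Oplus>\<^bsub>M i\<^esub>a\<in>A. f a i)"
proof -
  interpret P: abelian_monoid "product_module I M"
    by (rule abelian_monoid_product_module[OF M])
  interpret Mi: abelian_monoid "M i"
    by (rule M[OF i])
  have zero: "\<zero>\<^bsub>product_module I M\<^esub> i = \<zero>\<^bsub>M i\<^esub>"
    using i by (simp add: product_module_def)
  show ?thesis
    using f
  \<comment> \<open>Over an infinite set both sums take the default value zero, so that case closes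
    by \<open>zero\<close>, like the empty one.\<close>
  proof (induction A rule: infinite_finite_induct)
    case (insert a A)
    then have "f a \<in> carrier (product_module I M)" "f \<in> A \<rightarrow> carrier (product_module I M)"
      by auto
    moreover from this have "f a i \<in> carrier (M i)" "(\<lambda>b. f b i) \<in> A \<rightarrow> carrier (M i)"
      using i by (auto simp: product_module_def PiE_iff Pi_iff)
    ultimately show ?case
      using insert.hyps insert.IH i
      by (simp add: P.finsum_insert Mi.finsum_insert) (simp add: product_module_def)
  qed (simp_all add: zero)
qed

section \<open>Simplices, faces and incidence signs\<close>

lemma simplicial_complex_finite:
  assumes "simplicial_complex n K"
  shows "finite K"
proof (rule finite_subset)
  show "K \<subseteq> Pow {1..n}"
    using assms unfolding simplicial_complex_def by blast
qed simp

lemma simplicial_complex_finite_simplex: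
  assumes "simplicial_complex n K" "\<sigma> \<in> K"
  shows "finite \<sigma>"
proof (rule finite_subset)
  show "\<sigma> \<subseteq> {1..n}"
    using assms unfolding simplicial_complex_def by blast
qed simp

lemma simplicial_complex_subset:
  assumes "simplicial_complex n K" "\<tau> \<in> K" "\<sigma> \<noteq> {}" "\<sigma> \<subseteq> \<tau>"
  shows "\<sigma> \<in> K"
proof -
  have "\<forall>\<tau>\<in>K. \<forall>\<sigma>. \<sigma> \<noteq> {} \<and> \<sigma> \<subseteq> \<tau> \<longrightarrow> \<sigma> \<in> K"
    using assms(1) unfolding simplicial_complex_def by (elim conjE)
  from this[rule_format, OF assms(2)] show ?thesis
    using assms(3,4) by simp
qed

text \<open>A face determines the vertex it omits, and the sorted enumeration of \<tau> has no
  repetitions, so the vertex determines its position.\<close>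

lemma inj_on_face:
  assumes "finite \<tau>"
  shows "inj_on (\<lambda>k. face k \<tau>) {..<card \<tau>}"
proof (rule inj_onI)
  fix j k
  assume jk: "j \<in> {..<card \<tau>}" "k \<in> {..<card \<tau>}" and eq: "face j \<tau> = face k \<tau>"
  let ?l = "sorted_list_of_set \<tau>"
  have "?l ! j \<in> \<tau>" "?l ! k \<in> \<tau>"
    using jk assms nth_mem[of _ ?l] by auto
  then have "?l ! j = ?l ! k"
    using eq by (auto simp: face_def)
  then show "j = k"
    using jk assms by (simp add: nth_eq_iff_index_eq)
qed

text \<open>Injectivity of the face map makes the description \<open>THE\<close> in
  \<open>incidence\<close> denote \<open>k\<close>.\<close>

lemma incidence_face:
  assumes "finite \<tau>" "k < card \<tau>"
  shows "incidence (face k \<tau>) \<tau> = (-1) ^ k"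
proof -
  have "(THE j. j < card \<tau> \<and> face k \<tau> = face j \<tau>) = k"
    using assms inj_on_face[of \<tau>] by (intro the_equality) (auto dest: inj_onD)
  then show ?thesis
    using assms unfolding incidence_def by auto
qed

text \<open>Positivity of \<open>q\<close> keeps the face non-empty, which closure of
  \<open>K\<close> under subsets requires; the only face of a vertex is empty.\<close>

lemma face_in_simplices:
  assumes K: "simplicial_complex n K" and \<tau>: "\<tau> \<in> simplices K q" and "q > 0" "k < card \<tau>"
  shows "face k \<tau> \<in> simplices K (q - 1)"
proof -
  have \<tau>': "\<tau> \<in> K" "finite \<tau>" "int (card \<tau>) = q + 1"
    using \<tau> simplicial_complex_finite_simplex[OF K] by (auto simp: simplices_def)
  have "sorted_list_of_set \<tau> ! k \<in> \<tau>"
    using assms(4) \<tau>' nth_mem[of k "sorted_list_of_set \<tau>"] by simp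
  then have card: "int (card (face k \<tau>)) = q"
    using \<tau>' assms(4) by (simp add: face_def of_nat_diff)
  then have "face k \<tau> \<noteq> {}"
    using \<open>q > 0\<close> by auto
  moreover have "face k \<tau> \<subseteq> \<tau>"
    by (auto simp: face_def)
  ultimately have "face k \<tau> \<in> K"
    using simplicial_complex_subset[OF K \<tau>'(1)] by simp
  then show ?thesis
    using card by (simp add: simplices_def)
qed

section \<open>Chains and cochains as one product module\<close>

lemma chains_eq_product_module:
  assumes "finite K"
  shows "chains R K q = product_module (simplices K q) (\<lambda>_. self_module R)"
  using assms by (simp add: chains_def direct_sum_module_finite simplices_def)

lemma cochains_eq_chains:
  assumes "finite K" "\<And>\<sigma>. \<sigma> \<in> K \<Longrightarrow> F \<sigma> = self_module R"
  shows "cochains K F q = chains R K q"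
  unfolding chains_eq_product_module[OF assms(1)] cochains_def
  by (rule product_module_cong) (simp add: assms(2) simplices_def)

lemma chains_simps:
  assumes "finite K"
  shows "carrier (chains R K q) = simplices K q \<rightarrow>\<^sub>E carrier R"
    and "a \<odot>\<^bsub>chains R K q\<^esub> x = (\<lambda>\<sigma>\<in>simplices K q. a \<otimes>\<^bsub>R\<^esub> x \<sigma>)"
  by (simp_all add: chains_eq_product_module[OF assms] product_module_def)

lemma weight_quotients_closed:
  assumes "weight_quotients R K w quo" "\<sigma> \<in> K" "\<tau> \<in> K" "\<sigma> \<subseteq> \<tau>"
  shows "quo \<tau> \<sigma> \<in> carrier R"
  using assms unfolding weight_quotients_def by blast

section \<open>Comparison of the weighted boundary with the coboundary\<close>

context cring
begin

lemma abelian_monoid_self_module: "abelian_monoid (self_module R)"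
  by (rule abelian_monoidI) (auto intro: a_assoc a_comm)

lemma abelian_monoid_chains:
  assumes "finite K"
  shows "abelian_monoid (chains R K q)"
  unfolding chains_eq_product_module[OF assms]
  by (intro abelian_monoid_product_module abelian_monoid_self_module)

lemma finsum_chains_apply:
  assumes "finite K" "f \<in> A \<rightarrow> carrier (chains R K q)" "\<sigma> \<in> simplices K q"
  shows "finsum (chains R K q) f A \<sigma> = (\<Oplus>a\<in>A. f a \<sigma>)"
proof -
  note chains = chains_eq_product_module[OF assms(1)]
  have "finsum (chains R K q) f A \<sigma> = (\<Oplus>\<^bsub>self_module R\<^esub>a\<in>A. f a \<sigma>)"
    using assms(2,3) unfolding chains
    by (rule finsum_product_module_apply[OF abelian_monoid_self_module])
  then show ?thesis
    by (simp only: finsum_self_module)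
qed

text \<open>The coefficient formula is given the case distinction of
  \<open>coboundary_summand\<close>, so that the two maps can be compared one coefficient at a time.
  Both claims rest on the facts \<open>coeff\<close> and \<open>f\<close>, hence the joint
  proof.\<close>

lemma weighted_boundary_simplex_props:
  assumes K: "simplicial_complex n K" and \<tau>: "\<tau> \<in> simplices K q" and q: "q > 0"
    and quo: "weight_quotients R K w quo"
  shows weighted_boundary_simplex_closed:
      "weighted_boundary_simplex R K quo q \<tau> \<in> carrier (chains R K (q - 1))"
    and weighted_boundary_simplex_apply:
      "\<rho> \<in> simplices K (q - 1) \<Longrightarrow> weighted_boundary_simplex R K quo q \<tau> \<rho>
         = (if \<rho> \<subseteq> \<tau> then [incidence \<rho> \<tau>] \<cdot> quo \<tau> \<rho> else \<zero>)"
proof -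
  note fin = simplicial_complex_finite[OF K]
  interpret C: abelian_monoid "chains R K (q - 1)"
    by (rule abelian_monoid_chains[OF fin])
  have \<tau>': "finite \<tau>" "\<tau> \<in> K" "int (card \<tau>) = q + 1"
    using \<tau> simplicial_complex_finite_simplex[OF K] by (auto simp: simplices_def)
  \<comment> \<open>A simplex of dimension \<open>q\<close> has \<open>q + 1\<close> vertices, so
    the positions below \<open>card \<tau>\<close> are exactly the summation range of the
    boundary.\<close>
  have idx: "k < card \<tau> \<longleftrightarrow> k \<in> {0..nat q}" for k
    using \<tau>'(3) q by auto
  have coeff: "[((-1) ^ k :: int)] \<cdot> quo \<tau> (face k \<tau>) \<in> carrier R" if "k \<in> {0..nat q}" for k
  proof -
    have "face k \<tau> \<in> K" "face k \<tau> \<subseteq> \<tau>"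
      using face_in_simplices[OF K \<tau> q, of k] that idx by (auto simp: simplices_def face_def)
    then show ?thesis
      using weight_quotients_closed[OF quo] \<tau>'(2) by (intro add.int_pow_closed)
  qed
  define f where "f k = ([((-1) ^ k :: int)] \<cdot> quo \<tau> (face k \<tau>))
          \<odot>\<^bsub>chains R K (q - 1)\<^esub> basis_chain R K (q - 1) (face k \<tau>)" for k
  have bd: "weighted_boundary_simplex R K quo q \<tau> = finsum (chains R K (q - 1)) f {0..nat q}"
    unfolding weighted_boundary_simplex_def f_def ..
  have f: "f \<in> {0..nat q} \<rightarrow> carrier (chains R K (q - 1))"
    using coeff by (auto simp: f_def chains_simps[OF fin] basis_chain_def)
  show "weighted_boundary_simplex R K quo q \<tau> \<in> carrier (chains R K (q - 1))"
    unfolding bd using f by (rule C.finsum_closed)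
  assume \<rho>: "\<rho> \<in> simplices K (q - 1)"
  have eval: "weighted_boundary_simplex R K quo q \<tau> \<rho>
      = (\<Oplus>k\<in>{0..nat q}. if \<rho> = face k \<tau> then [((-1) ^ k :: int)] \<cdot> quo \<tau> (face k \<tau>) else \<zero>)"
    unfolding bd finsum_chains_apply[OF fin f \<rho>]
    using \<rho> coeff by (intro finsum_cong') (auto simp: f_def chains_simps[OF fin] basis_chain_def)
  show "weighted_boundary_simplex R K quo q \<tau> \<rho>
      = (if \<rho> \<subseteq> \<tau> then [incidence \<rho> \<tau>] \<cdot> quo \<tau> \<rho> else \<zero>)"
  proof (cases "\<exists>j<card \<tau>. \<rho> = face j \<tau>")
    case True
    then obtain j where j: "j < card \<tau>" "\<rho> = face j \<tau>"
      by blast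
    \<comment> \<open>The orientation \<open>j = k\<close> is the one that
      \<open>finsum_singleton\<close> expects.\<close>
    have "\<rho> = face k \<tau> \<longleftrightarrow> j = k" if "k \<in> {0..nat q}" for k
      using inj_on_face[OF \<tau>'(1)] j that idx by (auto dest: inj_onD)
    then have "weighted_boundary_simplex R K quo q \<tau> \<rho>
        = (\<Oplus>k\<in>{0..nat q}. if j = k then [((-1) ^ k :: int)] \<cdot> quo \<tau> (face k \<tau>) else \<zero>)"
      unfolding eval using coeff by (intro finsum_cong') auto
    also have "\<dots> = [((-1) ^ j :: int)] \<cdot> quo \<tau> (face j \<tau>)"
      using j idx coeff by (intro finsum_singleton) auto
    finally have "weighted_boundary_simplex R K quo q \<tau> \<rho>
        = [((-1) ^ j :: int)] \<cdot> quo \<tau> (face j \<tau>)" .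
    moreover have "\<rho> \<subseteq> \<tau>"
      using j by (auto simp: face_def)
    ultimately show ?thesis
      using j incidence_face[OF \<tau>'(1)] by simp
  next
    case False
    then have "weighted_boundary_simplex R K quo q \<tau> \<rho> = (\<Oplus>k\<in>{0..nat q}. \<zero>)"
      unfolding eval using idx by (intro finsum_cong') auto
    \<comment> \<open>The incidence sign is zero here, and a zero multiple is zero, so both branches
      of the \<open>if\<close> vanish.\<close>
    then show ?thesis
      using False by (auto simp: incidence_def add_pow_def)
  qed
qed

text \<open>Both maps sum a contribution of each simplex \<tau> in the same module, so it suffices
  to match these contributions coefficient by coefficient. Taking \<open>c\<close> in the carrier
  ensures that its coefficients obey the ring laws.\<close>

lemma weighted_boundary_eq_coboundary:
  assumes K: "simplicial_complex n K"
    and quo: "weight_quotients R K w quo"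
    and F: "\<And>\<sigma>. \<sigma> \<in> K \<Longrightarrow> F \<sigma> = self_module R"
    and res: "\<And>\<sigma> \<tau> r. \<lbrakk>\<sigma> \<in> K; \<tau> \<in> K; \<sigma> \<subseteq> \<tau>; r \<in> carrier R\<rbrakk> \<Longrightarrow> res \<tau> \<sigma> r = quo \<tau> \<sigma> \<otimes> r"
    and c: "c \<in> carrier (chains R K q)"
  shows "weighted_boundary R K quo q c = coboundary K F res q c"
proof -
  note fin = simplicial_complex_finite[OF K]
  have cochains: "cochains K F p = chains R K p" for p
    by (rule cochains_eq_chains[OF fin]) (rule F)
  show ?thesis
  proof (cases "q > 0")
    case True
    interpret C: abelian_monoid "chains R K (q - 1)"
      by (rule abelian_monoid_chains[OF fin])
    have summand: "c \<tau> \<odot>\<^bsub>chains R K (q - 1)\<^esub> weighted_boundary_simplex R K quo q \<tau>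
          = coboundary_summand K F res q \<tau> (c \<tau>)"
      and closed: "c \<tau> \<odot>\<^bsub>chains R K (q - 1)\<^esub> weighted_boundary_simplex R K quo q \<tau>
          \<in> carrier (chains R K (q - 1))"
      if \<tau>: "\<tau> \<in> simplices K q" for \<tau>
    proof -
      have \<tau>K: "\<tau> \<in> K"
        using \<tau> by (simp add: simplices_def)
      have c\<tau>: "c \<tau> \<in> carrier R"
        using c \<tau> by (auto simp: chains_simps[OF fin])
      note bd = weighted_boundary_simplex_props[OF K \<tau> True quo]
      show "c \<tau> \<odot>\<^bsub>chains R K (q - 1)\<^esub> weighted_boundary_simplex R K quo q \<tau>
          \<in> carrier (chains R K (q - 1))"
        using bd(1) c\<tau> by (auto simp: chains_simps[OF fin] PiE_iff)
      have "c \<tau> \<otimes> weighted_boundary_simplex R K quo q \<tau> \<rho>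
          = (if \<rho> \<subseteq> \<tau> then [incidence \<rho> \<tau>] \<cdot>\<^bsub>F \<rho>\<^esub> res \<tau> \<rho> (c \<tau>) else \<zero>\<^bsub>F \<rho>\<^esub>)"
        if \<rho>: "\<rho> \<in> simplices K (q - 1)" for \<rho>
      proof -
        have \<rho>K: "\<rho> \<in> K"
          using \<rho> by (simp add: simplices_def)
        \<comment> \<open>The scalar \<open>c \<tau>\<close> moves inside the signed multiple and
          then past the quotient; commutativity of \<open>R\<close> reconciles the chain scalar on
          the left with the sheaf map multiplying from the left.\<close>
        show ?thesis
          using c\<tau> \<rho>K \<tau>K weight_quotients_closed[OF quo]
          by (simp add: bd(2)[OF \<rho>] F res add_pow_self_module add_pow_rdistr_int m_comm)
      qed
      then show "c \<tau> \<odot>\<^bsub>chains R K (q - 1)\<^esub> weighted_boundary_simplex R K quo q \<tau>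
          = coboundary_summand K F res q \<tau> (c \<tau>)"
        unfolding chains_simps[OF fin] coboundary_summand_def by (intro restrict_ext)
    qed
    have "(\<Oplus>\<^bsub>chains R K (q - 1)\<^esub>\<tau>\<in>simplices K q.
              c \<tau> \<odot>\<^bsub>chains R K (q - 1)\<^esub> weighted_boundary_simplex R K quo q \<tau>)
        = (\<Oplus>\<^bsub>chains R K (q - 1)\<^esub>\<tau>\<in>simplices K q. coboundary_summand K F res q \<tau> (c \<tau>))"
      using summand closed by (intro C.finsum_cong') auto
    then show ?thesis
      using True by (simp add: weighted_boundary_def coboundary_def cochains)
  next
    case False
    \<comment> \<open>In degrees up to zero both maps are by definition the zero of their target,
      and the targets coincide.\<close>
    then show ?thesis
      by (simp add: weighted_boundary_def coboundary_def cochains)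
  qed
qed

end

text \<open>Kernel and image see the maps on the carriers only, and nothing else about
  \<open>d\<close> and \<open>e\<close> enters the quotient. The two boundary maps have been
  compared only there.\<close>

lemma homology_module_cong:
  assumes "\<And>x. x \<in> carrier L \<Longrightarrow> e x = e' x" "\<And>x. x \<in> carrier M \<Longrightarrow> d x = d' x"
  shows "homology_module L e M d N = homology_module L e' M d' N"
proof -
  have "e ` carrier L = e' ` carrier L"
    using assms(1) by (rule image_cong[OF refl])
  moreover have "a_kernel M N d = a_kernel M N d'"
    using assms(2) by (auto simp: a_kernel_def')
  ultimately show ?thesis
    by (simp add: homology_module_def)
qed

theorem theorem2:
  fixes n q :: nat
    and K :: "nat set set"
    and R :: "('a, 'r) ring_scheme"
    and w :: "nat set \<Rightarrow> 'a"
    and quo :: "nat set \<Rightarrow> nat set \<Rightarrow> 'a"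
    and F :: "nat set \<Rightarrow> ('a, 'a) module"
    and res :: "nat set \<Rightarrow> nat set \<Rightarrow> 'a \<Rightarrow> 'a"
  assumes "simplicial_complex n K"
    and "cring R"
    and "weight_function R K w"
    and "weight_quotients R K w quo"
    and "cellular_sheaf_op R K F res"
    and "\<And>\<sigma>. \<sigma> \<in> K \<Longrightarrow> F \<sigma> = self_module R"
    and "\<And>\<sigma> \<tau> r. \<lbrakk>\<sigma> \<in> K; \<tau> \<in> K; \<sigma> \<subseteq> \<tau>; r \<in> carrier R\<rbrakk> \<Longrightarrow> res \<tau> \<sigma> r = quo \<tau> \<sigma> \<otimes>\<^bsub>R\<^esub> r"
  shows "weighted_homology R K quo (int q) = sheaf_cohomology K F res (int q)"
proof -
  interpret cring R by fact
  have cochains: "cochains K F p = chains R K p" for p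
    by (rule cochains_eq_chains[OF simplicial_complex_finite[OF assms(1)]]) (rule assms(6))
  \<comment> \<open>The degree \<open>p\<close> stays arbitrary because homology in degree
    \<open>q\<close> involves the maps of degrees \<open>q\<close> and \<open>q + 1\<close>.\<close>
  have boundary: "weighted_boundary R K quo p c = coboundary K F res p c"
    if "c \<in> carrier (chains R K p)" for p c
    by (rule weighted_boundary_eq_coboundary[OF assms(1,4) _ _ that]) (simp_all add: assms(6,7))
  show ?thesis
    unfolding weighted_homology_def sheaf_cohomology_def cochains
    by (intro homology_module_cong boundary)
qed

end
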